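(* Let $L>0$ and consider the eigenvalue problem $$i\frac{dy}{dx}=\lambda y,\quad x\in(-L,L),\qquad y(-L)=y(L).$$ This problem has an infinite sequence of eigenvalues $\lambda_k=k\pi/L$, $k\in\mathbb{Z}$. The corresponding eigenfunctions $y_k(x)=\exp(-ik\pi x/L)$, $k\in\mathbb{Z}$, are orthogonal with respect to the inner product $\langle f,g\rangle=\int_{-L}^{L}f(x)\overline{g(x)}\,dx$. The set of eigenfunctions $\{y_k\}_{k\in\mathbb{Z}}$ is complete, and any function $f$ satisfying $\int_{-L}^{L}|f(x)|^2dx<\infty$ has the expansion $$f(x)\sim\sum_{k=-\infty}^{\infty}c_k e^{-i\frac{k\pi}{L}x},\qquad\text{where}\quad c_k=\frac{1}{2L}\int_{-L}^{L}f(x)e^{i\frac{k\pi}{L}x}\,dx,\quad k\in\mathbb{Z}.$$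
   Context: An eigenvalue of the problem is a number $\lambda\in\mathbb{C}$ for which the problem has a non-trivial solution (a solution that is not identically zero); the corresponding non-zero solutions are called eigenfunctions belonging to $\lambda$. Eigenfunctions are listed up to non-zero constant multiples. Completeness of the set of eigenfunctions means: if $\int_{-L}^{L}|f(x)|^2dx<\infty$ and $\int_{-L}^{L}f(x)\exp(ik\pi x/L)\,dx=0$ for all $k\in\mathbb{Z}$, then $f(x)=0$ for almost all $x\in[-L,L]$. The symbol $\sim$ denotes the eigenfunction expansion of $f$, understood as convergence of the series to $f$ in $L^2(-L,L)$. The series is called the complex Fourier series of $f$. *)

theory Defs
  imports "HOL-Analysis.Analysis"
begin

text \<open>
  Functions on \<open>[-L, L]\<close> are represented by total functions \<open>real \<Rightarrow> complex\<close>; their values outside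
  the interval play no role. A solution is a classical one: continuous up to the end points, so that
  the boundary condition is meaningful, and differentiable in the interior.
\<close>

definition is_solution :: "real \<Rightarrow> complex \<Rightarrow> (real \<Rightarrow> complex) \<Rightarrow> bool" where
  "is_solution L lam y \<longleftrightarrow>
     continuous_on {-L..L} y \<and>
     (\<forall>x\<in>{-L<..<L}. y differentiable (at x) \<and> \<i> * vector_derivative y (at x) = lam * y x) \<and>
     y (-L) = y L"

definition is_eigenfunction :: "real \<Rightarrow> complex \<Rightarrow> (real \<Rightarrow> complex) \<Rightarrow> bool" where
  "is_eigenfunction L lam y \<longleftrightarrow> is_solution L lam y \<and> (\<exists>x\<in>{-L..L}. y x \<noteq> 0)"

definition is_eigenvalue :: "real \<Rightarrow> complex \<Rightarrow> bool" where
  "is_eigenvalue L lam \<longleftrightarrow> (\<exists>y. is_eigenfunction L lam y)"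

definition fourier_eigenvalue :: "real \<Rightarrow> int \<Rightarrow> complex" where
  "fourier_eigenvalue L k = complex_of_real (of_int k * pi / L)"

definition fourier_eigenfunction :: "real \<Rightarrow> int \<Rightarrow> real \<Rightarrow> complex" where
  "fourier_eigenfunction L k x = exp (- \<i> * complex_of_real (of_int k * pi * x / L))"

definition square_integrable :: "real \<Rightarrow> (real \<Rightarrow> complex) \<Rightarrow> bool" where
  "square_integrable L f \<longleftrightarrow>
     f \<in> borel_measurable (lebesgue_on {-L..L}) \<and>
     integrable (lebesgue_on {-L..L}) (\<lambda>x. (cmod (f x))\<^sup>2)"

definition L2_inner :: "real \<Rightarrow> (real \<Rightarrow> complex) \<Rightarrow> (real \<Rightarrow> complex) \<Rightarrow> complex" where
  "L2_inner L f g = (LINT x|lebesgue_on {-L..L}. f x * cnj (g x))"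

definition L2_norm :: "real \<Rightarrow> (real \<Rightarrow> complex) \<Rightarrow> real" where
  "L2_norm L f = sqrt (LINT x|lebesgue_on {-L..L}. (cmod (f x))\<^sup>2)"

definition fourier_coeff :: "real \<Rightarrow> (real \<Rightarrow> complex) \<Rightarrow> int \<Rightarrow> complex" where
  "fourier_coeff L f k =
     1 / (2 * complex_of_real L) *
     (LINT x|lebesgue_on {-L..L}. f x * exp (\<i> * complex_of_real (of_int k * pi * x / L)))"

text \<open>
  Convergence of a two-sided series to \<open>f\<close> in \<open>L\<^sup>2(-L, L)\<close>: the lower and the upper summation limit
  tend to infinity independently of each other.
\<close>

definition L2_series_converges :: "real \<Rightarrow> (int \<Rightarrow> real \<Rightarrow> complex) \<Rightarrow> (real \<Rightarrow> complex) \<Rightarrow> bool" where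
  "L2_series_converges L a f \<longleftrightarrow>
     ((\<lambda>(m, n). L2_norm L (\<lambda>x. f x - (\<Sum>k = - int m..int n. a k x))) \<longlongrightarrow> 0)
       (sequentially \<times>\<^sub>F sequentially)"

end

theory Submission
  imports Defs
begin

text \<open>
  The differential equation forces \<open>y x = y (-L) * exp (- \<i> * lam * (x + L))\<close>, because
  \<open>y x * exp (\<i> * lam * x)\<close> has derivative zero. The boundary condition on a non-zero such function says
  \<open>exp (- 2 * \<i> * lam * L) = 1\<close>, that is, \<open>lam = k * pi / L\<close> for an integer \<open>k\<close>. In particular every
  eigenspace is spanned by one exponential. Orthogonality holds because an exponential with \<open>k \<noteq> 0\<close>
  has an antiderivative with equal values at \<open>-L\<close> and \<open>L\<close>.

  The analytic content is that trigonometric polynomials are dense in \<open>L\<^sup>2(-L, L)\<close>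
  (\<open>square_integrable_trig_approximable\<close>). Three reductions lead there. A square-integrable function
  is the \<open>L\<^sup>2\<close> limit of its truncations to bounded functions. A bounded measurable function is almost
  everywhere the limit of continuous functions with the same bound, which can also be made to vanish at
  \<open>-L\<close> and \<open>L\<close>; dominated convergence turns this into an \<open>L\<^sup>2\<close> limit. Finally, a continuous function
  with equal end values is a continuous function on the unit circle, where by Stone-Weierstrass it is
  a uniform limit of polynomials in the real and imaginary parts of \<open>z\<close>. On the circle these parts are
  \<open>(z + cnj z) / 2\<close> and \<open>(z - cnj z) / (2 * \<i>)\<close>, so that such polynomials are trigonometric polynomials in \<open>x\<close>.

  Density gives convergence because of two properties of the partial sums \<open>S\<close> of the Fourier series:
  they satisfy \<open>norm (g - S g) \<le> norm g\<close> for every square-integrable \<open>g\<close> (Bessel's inequality), and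
  they reproduce a trigonometric polynomial \<open>p\<close> as soon as all its frequencies are included. Hence
  \<open>f - S f = (f - p) - S (f - p)\<close> has norm at most \<open>norm (f - p)\<close>. Completeness is the case
  in which all partial sums vanish.
\<close>

section \<open>The eigenvalue problem\<close>

text \<open>
  Solutions of a linear first-order equation are determined by their initial value. The shift by \<open>L\<close>
  normalises the exponential to \<open>1\<close> at the left end point; the derivative argument uses only
  the interior, and continuity carries the conclusion to the end points.
\<close>

lemma is_solution_imp_exp:
  assumes "L > 0" and sol: "is_solution L lam y" and x: "x \<in> {-L..L}"
  shows "y x = y (-L) * exp (- \<i> * lam * complex_of_real (x + L))"
proof -
  let ?E = "\<lambda>x. exp (\<i> * lam * complex_of_real (x + L))"
  let ?h = "\<lambda>x. y x * ?E x"
  have contE: "continuous_on S ?E" for S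
    by (intro continuous_intros)
  have cont: "continuous_on {-L..L} ?h"
    using sol contE unfolding is_solution_def by (intro continuous_on_mult) auto
  have der: "(?h has_derivative (\<lambda>t. 0)) (at t within {-L..L})" if t: "t \<in> {-L..L} - {-L, L}" for t
  proof -
    let ?d = "vector_derivative y (at t)"
    have t': "t \<in> {-L<..<L}"
      using t by auto
    have "(y has_vector_derivative ?d) (at t)"
      using sol t' unfolding is_solution_def by (simp add: vector_derivative_works)
    moreover have "(?E has_vector_derivative (\<i> * lam * ?E t)) (at t)"
    proof -
      have "((\<lambda>z. exp (\<i> * lam * (z + complex_of_real L))) has_field_derivative (\<i> * lam * ?E t)) (at (complex_of_real t))"
        by (auto intro!: derivative_eq_intros)
      from has_vector_derivative_real_field[OF this] show ?thesis
        by simp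
    qed
    ultimately have "(?h has_vector_derivative (y t * (\<i> * lam * ?E t) + ?d * ?E t)) (at t)"
      by (rule has_vector_derivative_mult)
    moreover have "y t * (\<i> * lam * ?E t) + ?d * ?E t = 0"
    proof -
      have "\<i> * ?d = lam * y t"
        using sol t' unfolding is_solution_def by auto
      then have "- (\<i> * (\<i> * ?d)) = - (\<i> * (lam * y t))"
        by simp
      then have "?d = - (\<i> * (lam * y t))"
        by (simp add: mult.assoc[symmetric])
      then show ?thesis
        by (simp add: algebra_simps)
    qed
    ultimately have "(?h has_vector_derivative 0) (at t)"
      by simp
    then show ?thesis
      by (simp add: has_vector_derivative_def has_derivative_at_withinI)
  qed
  have "?h x = y (-L)"
    by (rule has_derivative_zero_unique_strong_interval[of "{-L, L}" "-L" L])
      (use cont der x in auto)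
  then have "y x * (?E x * exp (- (\<i> * lam * complex_of_real (x + L)))) = y (-L) * exp (- (\<i> * lam * complex_of_real (x + L)))"
    by (simp add: mult.assoc[symmetric])
  then show ?thesis
    by (simp only: exp_minus_inverse mult_1_right mult_minus_left)
qed

lemma fourier_eigenfunction_solution:
  assumes "L > 0" "\<And>x. x \<in> {-L..L} \<Longrightarrow> y x = c * fourier_eigenfunction L k x"
  shows "is_solution L (fourier_eigenvalue L k) y"
proof -
  let ?e = "\<lambda>x. c * fourier_eigenfunction L k x"
  have der: "(?e has_vector_derivative (- \<i> * fourier_eigenvalue L k * ?e x)) (at x)" for x
  proof -
    have "((\<lambda>z. c * exp (- \<i> * (fourier_eigenvalue L k * z))) has_field_derivative
            (- \<i> * fourier_eigenvalue L k * ?e x)) (at (complex_of_real x))"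
      unfolding fourier_eigenvalue_def fourier_eigenfunction_def
      using \<open>L > 0\<close> by (auto intro!: derivative_eq_intros)
    from has_vector_derivative_real_field[OF this] show ?thesis
      by (simp add: fourier_eigenvalue_def fourier_eigenfunction_def)
  qed
  have "continuous_on {-L..L} ?e"
    unfolding fourier_eigenfunction_def by (intro continuous_intros) (use \<open>L > 0\<close> in auto)
  then have cont: "continuous_on {-L..L} y"
    using assms(2) by (subst continuous_on_cong[OF refl]) auto
  have dy: "(y has_vector_derivative (- \<i> * fourier_eigenvalue L k * ?e x)) (at x)" if "x \<in> {-L<..<L}" for x
    by (rule has_vector_derivative_transform_within_open[OF der, where S = "{-L<..<L}"]) (use that assms(2) in auto)
  have "y differentiable (at x) \<and> \<i> * vector_derivative y (at x) = fourier_eigenvalue L k * y x"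
    if "x \<in> {-L<..<L}" for x
    using differentiableI_vector[OF dy[OF that]] vector_derivative_at[OF dy[OF that]] assms(2)[of x] that
    by (simp add: mult.assoc[symmetric])
  moreover have "y (-L) = y L"
  proof -
    have "exp (\<i> * of_int k * pi) = exp (- (\<i> * of_int k * pi))"
      by (subst exp_eq) (rule exI[of _ k], simp)
    then show ?thesis
      using assms by (simp add: fourier_eigenfunction_def mult.assoc)
  qed
  ultimately show ?thesis
    using cont unfolding is_solution_def by blast
qed

lemma eigenfunction_imp_exp:
  assumes "L > 0" "is_eigenfunction L lam y"
  shows "y (-L) \<noteq> 0" "x \<in> {-L..L} \<Longrightarrow> y x = y (-L) * exp (- \<i> * lam * complex_of_real (x + L))"
  using assms is_solution_imp_exp[OF assms(1)] unfolding is_eigenfunction_def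
  by (metis mult_zero_left)+

lemma eigenvalue_iff:
  assumes "L > 0"
  shows "is_eigenvalue L lam \<longleftrightarrow> lam \<in> range (fourier_eigenvalue L)"
proof
  assume "is_eigenvalue L lam"
  then obtain y where y: "is_eigenfunction L lam y"
    unfolding is_eigenvalue_def by auto
  have "y L = y (-L)"
    using y unfolding is_eigenfunction_def is_solution_def by simp
  moreover have "y L = y (-L) * exp (- \<i> * lam * complex_of_real (L + L))"
    using eigenfunction_imp_exp(2)[OF assms y, of L] assms by simp
  ultimately have "exp (- \<i> * lam * complex_of_real (L + L)) = 1"
    using eigenfunction_imp_exp(1)[OF assms y] by simp
  then obtain n :: int where "Im lam * (L + L) = 0" "- Re lam * (L + L) = of_int (2 * n) * pi"
    unfolding exp_eq_1 by auto
  then have "Im lam = 0" "Re lam = of_int (- n) * pi / L"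
    using assms by (auto simp: field_simps)
  then have "lam = fourier_eigenvalue L (- n)"
    unfolding fourier_eigenvalue_def by (simp add: complex_eq_iff)
  then show "lam \<in> range (fourier_eigenvalue L)"
    by blast
next
  assume "lam \<in> range (fourier_eigenvalue L)"
  then obtain k where "lam = fourier_eigenvalue L k"
    by auto
  moreover have "is_solution L (fourier_eigenvalue L k) (fourier_eigenfunction L k)"
    by (rule fourier_eigenfunction_solution[where c = 1]) (use assms in auto)
  moreover have "fourier_eigenfunction L k L \<noteq> 0"
    by (simp add: fourier_eigenfunction_def)
  ultimately show "is_eigenvalue L lam"
    using assms unfolding is_eigenvalue_def is_eigenfunction_def by force
qed

text \<open>
  The constant is \<open>c = y (-L) * exp (- \<i> * k * pi)\<close>: the unimodular factor undoes the shift of the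
  variable in \<open>is_solution_imp_exp\<close>.
\<close>

lemma eigenfunction_iff:
  assumes "L > 0"
  shows "is_eigenfunction L (fourier_eigenvalue L k) y \<longleftrightarrow>
          (\<exists>c. c \<noteq> 0 \<and> (\<forall>x\<in>{-L..L}. y x = c * fourier_eigenfunction L k x))"
proof
  assume y: "is_eigenfunction L (fourier_eigenvalue L k) y"
  let ?u = "exp (- \<i> * complex_of_real (of_int k * pi))"
  have "exp (- \<i> * fourier_eigenvalue L k * complex_of_real (x + L)) = ?u * fourier_eigenfunction L k x" for x
  proof -
    have "- \<i> * fourier_eigenvalue L k * complex_of_real (x + L)
        = - \<i> * complex_of_real (of_int k * pi) + - \<i> * complex_of_real (of_int k * pi * x / L)"
      using assms by (simp add: fourier_eigenvalue_def field_simps)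
    then show ?thesis
      unfolding fourier_eigenfunction_def by (simp only: exp_add)
  qed
  then have "y x = (y (-L) * ?u) * fourier_eigenfunction L k x" if "x \<in> {-L..L}" for x
    using eigenfunction_imp_exp(2)[OF assms y that] by (simp only: mult.assoc)
  moreover have "y (-L) * ?u \<noteq> 0"
    using eigenfunction_imp_exp(1)[OF assms y] by simp
  ultimately show "\<exists>c. c \<noteq> 0 \<and> (\<forall>x\<in>{-L..L}. y x = c * fourier_eigenfunction L k x)"
    by blast
next
  assume "\<exists>c. c \<noteq> 0 \<and> (\<forall>x\<in>{-L..L}. y x = c * fourier_eigenfunction L k x)"
  then obtain c where c: "c \<noteq> 0" "\<And>x. x \<in> {-L..L} \<Longrightarrow> y x = c * fourier_eigenfunction L k x"
    by blast
  have "y L \<noteq> 0"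
    using c(1) c(2)[of L] assms by (simp add: fourier_eigenfunction_def)
  then show "is_eigenfunction L (fourier_eigenvalue L k) y"
    using fourier_eigenfunction_solution[OF assms c(2)] assms
    unfolding is_eigenfunction_def by force
qed

section \<open>Orthogonality of the exponentials\<close>

lemma fourier_eigenfunction_add:
  "fourier_eigenfunction L (j + k) x = fourier_eigenfunction L j x * fourier_eigenfunction L k x"
  by (simp add: fourier_eigenfunction_def exp_add[symmetric] field_simps add_divide_distrib)

lemma cnj_fourier_eigenfunction:
  "cnj (fourier_eigenfunction L k x) = fourier_eigenfunction L (- k) x"
  by (simp add: fourier_eigenfunction_def exp_cnj)

lemma norm_fourier_eigenfunction [simp]: "norm (fourier_eigenfunction L k x) = 1"
  by (simp add: fourier_eigenfunction_def norm_exp_eq_Re)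

lemma fourier_eigenfunction_0 [simp]: "fourier_eigenfunction L 0 x = 1"
  by (simp add: fourier_eigenfunction_def)

lemma continuous_fourier_eigenfunction [continuous_intros]:
  assumes "L > 0"
  shows "continuous_on S (fourier_eigenfunction L k)"
  unfolding fourier_eigenfunction_def by (intro continuous_intros) (use assms in auto)

text \<open>
  For \<open>k \<noteq> 0\<close> an antiderivative is a multiple of the exponential itself, hence a solution of the
  boundary value problem; its equal end values make the integral vanish.
\<close>

lemma integral_fourier_eigenfunction:
  assumes "L > 0"
  shows "(LINT x|lebesgue_on {-L..L}. fourier_eigenfunction L k x) = (if k = 0 then 2 * complex_of_real L else 0)"
proof (cases "k = 0")
  case True
  then show ?thesis
    using assms by (simp add: measure_restrict_space scaleR_conv_of_real)
next
  case False
  \<comment> \<open>The antiderivative of the exponential with \<open>k \<noteq> 0\<close>.\<close>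
  define F where "F = (\<lambda>x. 1 / (- \<i> * fourier_eigenvalue L k) * fourier_eigenfunction L k x)"
  have nz: "fourier_eigenvalue L k \<noteq> 0"
    using False assms by (simp add: fourier_eigenvalue_def)
  have "is_solution L (fourier_eigenvalue L k) F"
    unfolding F_def by (rule fourier_eigenfunction_solution[OF assms refl])
  then have F: "continuous_on {-L..L} F" "F (-L) = F L"
      "\<And>x. x \<in> {-L<..<L} \<Longrightarrow> F differentiable (at x)"
      "\<And>x. x \<in> {-L<..<L} \<Longrightarrow> \<i> * vector_derivative F (at x) = fourier_eigenvalue L k * F x"
    unfolding is_solution_def by auto
  have "(F has_vector_derivative fourier_eigenfunction L k x) (at x)" if x: "x \<in> {-L<..<L}" for x
  proof -
    have "\<i> * vector_derivative F (at x) = \<i> * fourier_eigenfunction L k x"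
      using F(4)[OF x] nz by (simp add: F_def field_simps)
    then show ?thesis
      using F(3)[OF x] by (simp add: vector_derivative_works)
  qed
  then have "(fourier_eigenfunction L k has_integral (F L - F (-L))) {-L..L}"
    using F(1) assms by (intro fundamental_theorem_of_calculus_interior) auto
  moreover have "(fourier_eigenfunction L k has_integral
      (LINT x|lebesgue_on {-L..L}. fourier_eigenfunction L k x)) {-L..L}"
    by (intro has_integral_integral_lebesgue_on continuous_imp_integrable_real
        continuous_fourier_eigenfunction assms) simp
  ultimately show ?thesis
    using F(2) False by (simp add: has_integral_unique)
qed

lemma L2_inner_fourier_eigenfunction:
  assumes "L > 0" "j \<noteq> k"
  shows "L2_inner L (fourier_eigenfunction L j) (fourier_eigenfunction L k) = 0"
  using assms integral_fourier_eigenfunction[OF assms(1), of "j - k"]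
  by (simp add: L2_inner_def cnj_fourier_eigenfunction fourier_eigenfunction_add[symmetric])

section \<open>Square-integrable functions\<close>

lemma continuous_imp_square_integrable:
  assumes "continuous_on {-L..L} f"
  shows "square_integrable L f"
  using assms unfolding square_integrable_def
  by (auto intro!: continuous_imp_measurable_on_sets_lebesgue continuous_imp_integrable_real continuous_intros)

lemma square_integrable_scale:
  "square_integrable L f \<Longrightarrow> square_integrable L (\<lambda>x. c * f x)"
  unfolding square_integrable_def by (auto simp: norm_mult power_mult_distrib)

lemma norm_add_square_le: "(norm (u + v))\<^sup>2 \<le> 2 * (norm u)\<^sup>2 + 2 * (norm v)\<^sup>2"
  for u v :: "'a::real_normed_vector"
proof -
  have "(norm (u + v))\<^sup>2 \<le> (norm u + norm v)\<^sup>2"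
    by (simp add: norm_triangle_ineq power_mono)
  also have "\<dots> \<le> 2 * (norm u)\<^sup>2 + 2 * (norm v)\<^sup>2"
    using sum_squares_bound[of "norm u" "norm v"] by (simp add: power2_sum)
  finally show ?thesis .
qed

lemma square_integrable_add:
  assumes "square_integrable L f" "square_integrable L g"
  shows "square_integrable L (\<lambda>x. f x + g x)"
proof -
  have [measurable]: "f \<in> borel_measurable (lebesgue_on {-L..L})" "g \<in> borel_measurable (lebesgue_on {-L..L})"
    using assms unfolding square_integrable_def by auto
  have "integrable (lebesgue_on {-L..L}) (\<lambda>x. (norm (f x + g x))\<^sup>2)"
    by (rule Bochner_Integration.integrable_bound[where f = "\<lambda>x. 2 * (norm (f x))\<^sup>2 + 2 * (norm (g x))\<^sup>2"])
      (use assms norm_add_square_le in \<open>auto simp: square_integrable_def\<close>)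
  then show ?thesis
    unfolding square_integrable_def by auto
qed

lemma square_integrable_diff:
  assumes "square_integrable L f" "square_integrable L g"
  shows "square_integrable L (\<lambda>x. f x - g x)"
  using square_integrable_add[OF assms(1) square_integrable_scale[OF assms(2), of "-1"]] by simp

lemma L2_norm_square: "(L2_norm L f)\<^sup>2 = (LINT x|lebesgue_on {-L..L}. (cmod (f x))\<^sup>2)"
  unfolding L2_norm_def by simp

lemma L2_norm_nonneg [simp]: "0 \<le> L2_norm L f"
  unfolding L2_norm_def by simp

text \<open>
  A triangle inequality up to a constant, which suffices for approximation arguments. The
  factor comes from the pointwise bound \<open>norm_add_square_le\<close>.
\<close>

lemma L2_norm_add_le:
  assumes "square_integrable L f" "square_integrable L g"
  shows "L2_norm L (\<lambda>x. f x + g x) \<le> 2 * (L2_norm L f + L2_norm L g)"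
proof (rule power2_le_imp_le)
  have "(L2_norm L (\<lambda>x. f x + g x))\<^sup>2
      \<le> (LINT x|lebesgue_on {-L..L}. 2 * (cmod (f x))\<^sup>2 + 2 * (cmod (g x))\<^sup>2)"
    unfolding L2_norm_square
    by (intro integral_mono) (use square_integrable_add[OF assms] assms norm_add_square_le in \<open>auto simp: square_integrable_def\<close>)
  also have "\<dots> = 2 * (L2_norm L f)\<^sup>2 + 2 * (L2_norm L g)\<^sup>2"
    unfolding L2_norm_square using assms by (simp add: square_integrable_def)
  also have "\<dots> \<le> (2 * (L2_norm L f + L2_norm L g))\<^sup>2"
    by (simp add: power2_eq_square algebra_simps)
  finally show "(L2_norm L (\<lambda>x. f x + g x))\<^sup>2 \<le> (2 * (L2_norm L f + L2_norm L g))\<^sup>2" .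
qed simp

text \<open>
  The interval has finite measure, so \<open>norm (f x) \<le> 1 + (norm (f x))\<^sup>2\<close> gives an integrable bound.
\<close>

lemma square_integrable_mult_eigenfunction:
  assumes "L > 0" "square_integrable L f"
  shows "integrable (lebesgue_on {-L..L}) (\<lambda>x. f x * fourier_eigenfunction L k x)"
proof -
  have [measurable]: "f \<in> borel_measurable (lebesgue_on {-L..L})"
    using assms unfolding square_integrable_def by auto
  have [measurable]: "fourier_eigenfunction L k \<in> borel_measurable (lebesgue_on {-L..L})"
    using continuous_imp_square_integrable[OF continuous_fourier_eigenfunction[OF assms(1)]]
    unfolding square_integrable_def by auto
  have bound: "norm (f x) \<le> 1 + (norm (f x))\<^sup>2" for x
  proof -
    have "2 * norm (f x) \<le> 1 + (norm (f x))\<^sup>2"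
      using sum_squares_bound[of 1 "norm (f x)"] by simp
    then show ?thesis
      using norm_ge_zero[of "f x"] by linarith
  qed
  show ?thesis
    by (rule Bochner_Integration.integrable_bound[where f = "\<lambda>x. 1 + (norm (f x))\<^sup>2"])
      (use assms bound in \<open>auto simp: square_integrable_def norm_mult\<close>)
qed

lemma L2_dominated_convergence:
  assumes [measurable]: "f \<in> borel_measurable (lebesgue_on {-L..L})"
      "\<And>n. s n \<in> borel_measurable (lebesgue_on {-L..L})"
    and w: "integrable (lebesgue_on {-L..L}) w"
    and lim: "AE x in lebesgue_on {-L..L}. (\<lambda>n. s n x) \<longlonglongrightarrow> f x"
    and bound: "\<And>n x. x \<in> {-L..L} \<Longrightarrow> (norm (f x - s n x))\<^sup>2 \<le> w x"
  shows "(\<lambda>n. L2_norm L (\<lambda>x. f x - s n x)) \<longlonglongrightarrow> 0"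
proof -
  have "(\<lambda>n. LINT x|lebesgue_on {-L..L}. (norm (f x - s n x))\<^sup>2) \<longlonglongrightarrow> (LINT x|lebesgue_on {-L..L}. 0)"
  proof (rule integral_dominated_convergence[where w = w])
    show "AE x in lebesgue_on {-L..L}. (\<lambda>n. (norm (f x - s n x))\<^sup>2) \<longlonglongrightarrow> 0"
      using lim
    proof eventually_elim
      case (elim x)
      then have "(\<lambda>n. (norm (f x - s n x))\<^sup>2) \<longlonglongrightarrow> (norm (f x - f x))\<^sup>2"
        by (intro tendsto_intros)
      then show ?case
        by simp
    qed
  qed (use w bound in \<open>auto intro!: AE_I2\<close>)
  then show ?thesis
    unfolding L2_norm_def using tendsto_real_sqrt by fastforce
qed

section \<open>Trigonometric polynomials\<close>

text \<open>
  The complex span of the exponentials. It is given by closure rules so that linear properties pass to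
  it by induction, without a choice of coefficients.
\<close>

inductive trig_poly :: "real \<Rightarrow> (real \<Rightarrow> complex) \<Rightarrow> bool" for L where
  basis: "trig_poly L (fourier_eigenfunction L k)"
| scale: "trig_poly L p \<Longrightarrow> trig_poly L (\<lambda>x. c * p x)"
| add: "trig_poly L p \<Longrightarrow> trig_poly L q \<Longrightarrow> trig_poly L (\<lambda>x. p x + q x)"

lemma trig_poly_const: "trig_poly L (\<lambda>x. c)"
  using trig_poly.scale[OF trig_poly.basis[of L 0], of c] by simp

lemma trig_poly_mult:
  assumes "trig_poly L p" "trig_poly L q"
  shows "trig_poly L (\<lambda>x. p x * q x)"
  using assms(1)
proof induction
  case (basis j)
  show ?case
    using assms(2)
  proof induction
    case (basis k)
    then show ?case
      using trig_poly.basis[of L "j + k"] by (simp add: fourier_eigenfunction_add[abs_def])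
  next
    case (scale q c)
    then show ?case
      using trig_poly.scale[OF scale.IH, of c] by (simp add: mult.left_commute)
  next
    case (add q r)
    then show ?case
      using trig_poly.add[OF add.IH] by (simp add: distrib_left)
  qed
next
  case (scale p c)
  then show ?case
    using trig_poly.scale[OF scale.IH, of c] by (simp add: mult.assoc)
next
  case (add p r)
  then show ?case
    using trig_poly.add[OF add.IH] by (simp add: distrib_right)
qed

lemma continuous_trig_poly:
  assumes "L > 0" "trig_poly L p"
  shows "continuous_on S p"
  using assms(2) by induction (intro continuous_intros continuous_fourier_eigenfunction assms(1); assumption)+

lemma square_integrable_trig_poly:
  "L > 0 \<Longrightarrow> trig_poly L p \<Longrightarrow> square_integrable L p"
  by (rule continuous_imp_square_integrable[OF continuous_trig_poly])

text \<open>
  The exponential with \<open>k = 1\<close> runs through the unit circle, where \<open>cnj z\<close> is the exponential with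
  \<open>k = -1\<close>. A real-linear form \<open>g\<close> is a complex combination of \<open>z\<close> and \<open>cnj z\<close>; sums and products
  of such forms stay among the trigonometric polynomials.
\<close>

lemma trig_poly_real_polynomial_on_circle:
  assumes "real_polynomial_function (g :: complex \<Rightarrow> real)"
  shows "trig_poly L (\<lambda>x. complex_of_real (g (fourier_eigenfunction L 1 x)))"
  using assms
proof induction
  case (linear g)
  interpret bounded_linear g by fact
  let ?a = "(g 1 - \<i> * g \<i>) / 2" and ?b = "(g 1 + \<i> * g \<i>) / 2"
  have g_eq: "complex_of_real (g z) = ?a * z + ?b * cnj z" for z
  proof -
    have "g z = g (Re z *\<^sub>R 1 + Im z *\<^sub>R \<i>)"
      by (metis complex_eq scaleR_conv_of_real mult.commute mult.right_neutral)
    also have "\<dots> = Re z * g 1 + Im z * g \<i>"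
      unfolding add scaleR by simp
    finally show ?thesis
      by (simp add: complex_eq_iff field_simps)
  qed
  have "complex_of_real (g (fourier_eigenfunction L 1 x))
      = ?a * fourier_eigenfunction L 1 x + ?b * fourier_eigenfunction L (-1) x" for x
    using g_eq[of "fourier_eigenfunction L 1 x"] unfolding cnj_fourier_eigenfunction .
  moreover have "trig_poly L (\<lambda>x. ?a * fourier_eigenfunction L 1 x + ?b * fourier_eigenfunction L (-1) x)"
    by (intro trig_poly.intros)
  ultimately show ?case
    by (simp only:)
next
  case (const c)
  show ?case by (rule trig_poly_const)
next
  case (add f g)
  then show ?case
    using trig_poly.add[OF add.IH] by simp
next
  case (mult f g)
  then show ?case
    using trig_poly_mult[OF mult.IH] by simp
qed

lemma trig_poly_polynomial_on_circle:
  assumes "polynomial_function (g :: complex \<Rightarrow> complex)"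
  shows "trig_poly L (\<lambda>x. g (fourier_eigenfunction L 1 x))"
proof -
  have "real_polynomial_function (Re \<circ> g)" "real_polynomial_function (Im \<circ> g)"
    using assms bounded_linear_Re bounded_linear_Im unfolding polynomial_function_def by auto
  then have "trig_poly L (\<lambda>x. complex_of_real ((Re \<circ> g) (fourier_eigenfunction L 1 x))
        + \<i> * complex_of_real ((Im \<circ> g) (fourier_eigenfunction L 1 x)))"
    by (intro trig_poly.add trig_poly.scale trig_poly_real_polynomial_on_circle)
  then show ?thesis
    by (simp add: complex_eq[symmetric])
qed

section \<open>Density of the trigonometric polynomials\<close>

lemma fourier_eigenfunction_1_onto_circle:
  assumes "L > 0"
  shows "fourier_eigenfunction L 1 ` {-L..L} = sphere 0 1"
proof
  show "sphere 0 1 \<subseteq> fourier_eigenfunction L 1 ` {-L..L}"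
  proof
    fix z :: complex assume "z \<in> sphere 0 1"
    then have z: "norm z = 1"
      by simp
    then have nz: "z \<noteq> 0"
      by auto
    \<comment> \<open>The minus sign appears because \<open>exp (- \<i> * pi * x / L)\<close> runs clockwise.\<close>
    define x where "x = - L * Arg z / pi"
    have "- pi < Arg z" "Arg z \<le> pi"
      using mpi_less_Arg Arg_le_pi by auto
    then have "L * Arg z \<le> L * pi" "L * (- pi) \<le> L * Arg z"
      using assms by (intro mult_left_mono; simp)+
    then have "x \<in> {-L..L}"
      unfolding x_def by (auto simp: field_simps)
    moreover have "fourier_eigenfunction L 1 x = z"
      using Arg_eq[OF nz] z assms by (simp add: fourier_eigenfunction_def x_def)
    ultimately show "z \<in> fourier_eigenfunction L 1 ` {-L..L}"
      by blast
  qed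
qed auto

text \<open>
  The map to the circle identifies only the two end points: the interval \<open>[-L, L]\<close> is exactly one period.
\<close>

lemma fourier_eigenfunction_1_eq_imp:
  assumes "L > 0" "x \<in> {-L..L}" "t \<in> {-L..L}"
    and eq: "fourier_eigenfunction L 1 x = fourier_eigenfunction L 1 t"
  shows "x = t \<or> {x, t} = {-L, L}"
proof -
  obtain n :: int where "- \<i> * complex_of_real (pi * x / L) = - \<i> * complex_of_real (pi * t / L) + of_int (2 * n) * pi * \<i>"
    using eq unfolding fourier_eigenfunction_def exp_eq by auto
  then have "- (pi * x / L) = - (pi * t / L) + 2 * n * pi"
    by (auto simp: complex_eq_iff)
  then have "pi * (t - x) = pi * (2 * n * L)"
    using assms(1) by (simp add: field_simps)
  then have n: "t - x = 2 * n * L"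
    by simp
  then have "\<bar>2 * n * L\<bar> \<le> 2 * L"
    using assms by auto
  then have "\<bar>real_of_int n\<bar> \<le> 1"
    using assms(1) by (simp add: abs_mult)
  then have "n = 0 \<or> n = 1 \<or> n = -1"
    by linarith
  then show ?thesis
    using n assms by auto
qed

text \<open>
  A continuous map from the compact interval onto the circle is a quotient map, so a continuous function
  that respects its identifications descends to a continuous function on the circle.
\<close>

lemma continuous_periodic_factors_through_circle:
  fixes h :: "real \<Rightarrow> complex"
  assumes "L > 0" and h: "continuous_on {-L..L} h" "h (-L) = h L"
  obtains H where "continuous_on (sphere 0 1) H"
    "\<And>x. x \<in> {-L..L} \<Longrightarrow> H (fourier_eigenfunction L 1 x) = h x"
proof -
  have q: "quotient_map (top_of_set {-L..L}) (top_of_set (sphere 0 1)) (fourier_eigenfunction L 1)"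
    by (rule continuous_imp_quotient_map)
      (use fourier_eigenfunction_1_onto_circle[OF assms(1)] in
        \<open>auto simp: compact_space_subtopology Hausdorff_space_subtopology continuous_fourier_eigenfunction[OF assms(1)]\<close>)
  have hcont: "continuous_map (top_of_set {-L..L}) euclidean h"
    using h(1) by simp
  show ?thesis
  proof (rule quotient_map_lift_exists[where h = h, OF q hcont])
    fix x t
    assume "x \<in> topspace (top_of_set {-L..L})" "t \<in> topspace (top_of_set {-L..L})"
      "fourier_eigenfunction L 1 x = fourier_eigenfunction L 1 t"
    then show "h x = h t"
      using fourier_eigenfunction_1_eq_imp[OF assms(1), of x t] h(2) by (auto simp: doubleton_eq_iff)
  next
    fix H
    assume "continuous_map (top_of_set (sphere 0 1)) euclidean H"
      "\<And>x. x \<in> topspace (top_of_set {-L..L}) \<Longrightarrow> H (fourier_eigenfunction L 1 x) = h x"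
    then show ?thesis
      by (intro that) auto
  qed
qed

lemma trig_poly_uniformly_dense:
  fixes h :: "real \<Rightarrow> complex"
  assumes "L > 0" "continuous_on {-L..L} h" "h (-L) = h L" "e > 0"
  obtains p where "trig_poly L p" "\<And>x. x \<in> {-L..L} \<Longrightarrow> norm (h x - p x) < e"
proof -
  obtain H where H: "continuous_on (sphere 0 1) H"
      "\<And>x. x \<in> {-L..L} \<Longrightarrow> H (fourier_eigenfunction L 1 x) = h x"
    using continuous_periodic_factors_through_circle[OF assms(1-3)] by blast
  obtain g where g: "polynomial_function g" "\<And>z. z \<in> sphere 0 1 \<Longrightarrow> norm (H z - g z) < e"
    using Stone_Weierstrass_polynomial_function[OF compact_sphere H(1) \<open>e > 0\<close>] by blast
  show ?thesis
  proof
    show "trig_poly L (\<lambda>x. g (fourier_eigenfunction L 1 x))"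
      by (rule trig_poly_polynomial_on_circle) fact
    show "norm (h x - g (fourier_eigenfunction L 1 x)) < e" if "x \<in> {-L..L}" for x
      using g(2)[of "fourier_eigenfunction L 1 x"] H(2)[OF that] by simp
  qed
qed

definition trig_approximable :: "real \<Rightarrow> (real \<Rightarrow> complex) \<Rightarrow> bool" where
  "trig_approximable L f \<longleftrightarrow> (\<forall>e>0. \<exists>p. trig_poly L p \<and> L2_norm L (\<lambda>x. f x - p x) < e)"

lemma trig_approximable_periodic:
  assumes "L > 0" "continuous_on {-L..L} h" "h (-L) = h L"
  shows "trig_approximable L h"
  unfolding trig_approximable_def
proof (intro allI impI)
  fix e :: real assume "e > 0"
  \<comment> \<open>A uniform error \<open>d\<close> on an interval of length \<open>2 * L\<close> has \<open>L\<^sup>2\<close> norm at most \<open>d * sqrt (2 * L)\<close>.\<close>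
  define d where "d = e / (2 * sqrt (2 * L))"
  have "d > 0"
    using \<open>e > 0\<close> assms(1) by (simp add: d_def)
  then obtain p where p: "trig_poly L p" "\<And>x. x \<in> {-L..L} \<Longrightarrow> norm (h x - p x) < d"
    using trig_poly_uniformly_dense[OF assms] by blast
  have "square_integrable L (\<lambda>x. h x - p x)"
    by (intro square_integrable_diff continuous_imp_square_integrable[OF assms(2)]
        square_integrable_trig_poly[OF assms(1) p(1)])
  then have "(LINT x|lebesgue_on {-L..L}. (norm (h x - p x))\<^sup>2) \<le> (LINT x|lebesgue_on {-L..L}. d\<^sup>2)"
    by (intro integral_mono) (use p(2) in \<open>auto simp: square_integrable_def less_imp_le intro!: power_mono\<close>)
  also have "\<dots> = (d * sqrt (2 * L))\<^sup>2"
    using assms(1) by (simp add: measure_restrict_space power_mult_distrib)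
  finally have "(L2_norm L (\<lambda>x. h x - p x))\<^sup>2 \<le> (d * sqrt (2 * L))\<^sup>2"
    by (simp add: L2_norm_square)
  then have "L2_norm L (\<lambda>x. h x - p x) \<le> d * sqrt (2 * L)"
    by (rule power2_le_imp_le) (use \<open>d > 0\<close> assms(1) in simp)
  also have "\<dots> = e / 2"
    using assms(1) by (simp add: d_def)
  also have "\<dots> < e"
    using \<open>e > 0\<close> by simp
  finally show "\<exists>p. trig_poly L p \<and> L2_norm L (\<lambda>x. h x - p x) < e"
    using p(1) by blast
qed

lemma trig_approximable_limit:
  assumes "L > 0" and f: "square_integrable L f" and s: "\<And>n. square_integrable L (s n)"
    and lim: "(\<lambda>n. L2_norm L (\<lambda>x. f x - s n x)) \<longlonglongrightarrow> 0"
    and approx: "\<And>n. trig_approximable L (s n)"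
  shows "trig_approximable L f"
  unfolding trig_approximable_def
proof (intro allI impI)
  fix e :: real assume "e > 0"
  then have "e / 4 > 0"
    by simp
  then obtain n where n: "L2_norm L (\<lambda>x. f x - s n x) < e / 4"
    using order_tendstoD(2)[OF lim] by (meson eventually_sequentially order_refl)
  obtain p where p: "trig_poly L p" "L2_norm L (\<lambda>x. s n x - p x) < e / 4"
    using approx[of n] \<open>e / 4 > 0\<close> unfolding trig_approximable_def by blast
  have "square_integrable L p"
    by (rule square_integrable_trig_poly[OF assms(1) p(1)])
  then have "L2_norm L (\<lambda>x. (f x - s n x) + (s n x - p x)) < e"
    using L2_norm_add_le[OF square_integrable_diff[OF f s[of n]] square_integrable_diff[OF s[of n]]] n p(2)
    by fastforce
  then show "\<exists>p. trig_poly L p \<and> L2_norm L (\<lambda>x. f x - p x) < e"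
    using p(1) by auto
qed

text \<open>
  The nearest-point projection \<open>T\<close> onto a ball is continuous and bounded, so \<open>T\<close> composed with continuous functions
  that converge to \<open>f\<close> almost everywhere gives continuous functions with a common bound that converge to \<open>T \<circ> f\<close>.
  Multiplying them by continuous cut-offs that vanish at \<open>-L\<close> and \<open>L\<close> and increase to \<open>1\<close> in the
  interior makes them periodic and changes neither the bound nor the limit almost everywhere.
\<close>

lemma trig_approximable_truncation:
  assumes "L > 0" and f: "f \<in> borel_measurable (lebesgue_on {-L..L})" and "M \<ge> 0"
  defines "T \<equiv> closest_point (cball (0::complex) M)"
  shows "square_integrable L (\<lambda>x. T (f x))" "trig_approximable L (\<lambda>x. T (f x))"
proof -
  have contT: "continuous_on S T" for S
    unfolding T_def using \<open>M \<ge> 0\<close> by (intro continuous_on_closest_point) auto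
  have normT: "norm (T z) \<le> M" for z
    using closest_point_in_set[of "cball (0::complex) M" z] \<open>M \<ge> 0\<close> unfolding T_def by auto
  have measT: "(\<lambda>x. T (f x)) \<in> borel_measurable (lebesgue_on {-L..L})"
    using f contT by (rule borel_measurable_continuous_on[rotated])
  show sq: "square_integrable L (\<lambda>x. T (f x))"
    unfolding square_integrable_def
  proof
    show "integrable (lebesgue_on {-L..L}) (\<lambda>x. (norm (T (f x)))\<^sup>2)"
      by (rule Bochner_Integration.integrable_bound[where f = "\<lambda>x. M\<^sup>2"])
        (use measT normT in \<open>auto intro!: AE_I2 power_mono\<close>)
  qed (rule measT)
  have "f measurable_on {-L..L}"
    using f by (simp add: measurable_on_iff_borel_measurable)
  then obtain N g where N: "negligible N" and g: "\<And>n. continuous_on UNIV (g n)"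
    and gf: "\<And>x. x \<notin> N \<Longrightarrow> (\<lambda>n. g n x) \<longlonglongrightarrow> (if x \<in> {-L..L} then f x else 0)"
    unfolding measurable_on_def by blast
  define c where "c = (\<lambda>n x. min 1 (real n * (L - \<bar>x\<bar>)))"
  define s where "s = (\<lambda>n x. c n x *\<^sub>R T (g n x))"
  have c01: "0 \<le> c n x" "c n x \<le> 1" if "x \<in> {-L..L}" for n x
    using that unfolding c_def by auto
  have clim: "(\<lambda>n. c n x) \<longlonglongrightarrow> 1" if x: "x \<in> {-L<..<L}" for x
  proof (rule tendsto_eventually)
    have "L - \<bar>x\<bar> > 0"
      using x by auto
    then obtain n0 where n0: "1 < real n0 * (L - \<bar>x\<bar>)"
      using reals_Archimedean3 by blast
    show "\<forall>\<^sub>F n in sequentially. c n x = 1"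
    proof (rule eventually_sequentiallyI[of n0])
      fix n assume "n0 \<le> n"
      then have "real n0 * (L - \<bar>x\<bar>) \<le> real n * (L - \<bar>x\<bar>)"
        using \<open>L - \<bar>x\<bar> > 0\<close> by (intro mult_right_mono) auto
      then show "c n x = 1"
        unfolding c_def using n0 by linarith
    qed
  qed
  have conts: "continuous_on {-L..L} (s n)" for n
    unfolding s_def c_def
    by (intro continuous_intros continuous_on_compose2[OF contT[of UNIV]] continuous_on_subset[OF g]) auto
  have norms: "norm (s n x) \<le> M" if "x \<in> {-L..L}" for n x
    using mult_mono[OF c01(2)[OF that, of n] normT[of "g n x"]] c01(1)[OF that, of n] by (simp add: s_def)
  have "(\<lambda>n. L2_norm L (\<lambda>x. T (f x) - s n x)) \<longlonglongrightarrow> 0"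
  proof (rule L2_dominated_convergence[where w = "\<lambda>x. (2 * M)\<^sup>2"])
    show "s n \<in> borel_measurable (lebesgue_on {-L..L})" for n
      using continuous_imp_square_integrable[OF conts] unfolding square_integrable_def by auto
    show "(norm (T (f x) - s n x))\<^sup>2 \<le> (2 * M)\<^sup>2" if "x \<in> {-L..L}" for n x
      using norm_triangle_ineq4[of "T (f x)" "s n x"] normT[of "f x"] norms[OF that, of n]
      by (intro power_mono) auto
    have "AE x in lebesgue. x \<notin> N \<union> {-L, L}"
      using N by (intro AE_not_in) (simp add: negligible_iff_null_sets[symmetric] negligible_Un)
    then have "AE x in lebesgue_on {-L..L}. x \<notin> N \<union> {-L, L}"
      by (subst AE_restrict_space_iff) (auto elim: eventually_mono)
    then show "AE x in lebesgue_on {-L..L}. (\<lambda>n. s n x) \<longlonglongrightarrow> T (f x)"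
      using AE_space
    proof eventually_elim
      case (elim x)
      then have x: "x \<in> {-L<..<L}" "x \<notin> N"
        by (auto simp: less_le)
      have "(\<lambda>n. g n x) \<longlonglongrightarrow> f x"
        using gf[OF x(2)] x(1) by simp
      then have "(\<lambda>n. T (g n x)) \<longlonglongrightarrow> T (f x)"
        by (rule continuous_on_tendsto_compose[OF contT[of UNIV]]) auto
      from tendsto_scaleR[OF clim[OF x(1)] this] show ?case
        by (simp add: s_def)
    qed
  qed (use measT in auto)
  moreover have "trig_approximable L (s n)" for n
    by (rule trig_approximable_periodic[OF assms(1) conts]) (use assms(1) in \<open>simp add: s_def c_def\<close>)
  ultimately show "trig_approximable L (\<lambda>x. T (f x))"
    using trig_approximable_limit[OF assms(1) sq] continuous_imp_square_integrable[OF conts] by blast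
qed

text \<open>
  Projecting \<open>f x\<close> to a ball about \<open>0\<close> moves it by at most \<open>norm (f x)\<close>, so the squared error of the
  truncations is dominated by \<open>(norm (f x))\<^sup>2\<close>; at each point the truncation is eventually exact.
\<close>

lemma square_integrable_trig_approximable:
  assumes "L > 0" "square_integrable L f"
  shows "trig_approximable L f"
proof -
  define T where "T n = closest_point (cball (0::complex) (real n))" for n :: nat
  have f: "f \<in> borel_measurable (lebesgue_on {-L..L})"
    "integrable (lebesgue_on {-L..L}) (\<lambda>x. (cmod (f x))\<^sup>2)"
    using assms(2) unfolding square_integrable_def by auto
  note T = trig_approximable_truncation[OF assms(1) f(1), of "real n" for n, folded T_def, simplified]
  have "(\<lambda>n. L2_norm L (\<lambda>x. f x - T n (f x))) \<longlonglongrightarrow> 0"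
  proof (rule L2_dominated_convergence[OF f(1) _ f(2)])
    show "(\<lambda>x. T n (f x)) \<in> borel_measurable (lebesgue_on {-L..L})" for n
      using T(1)[of n] unfolding square_integrable_def by simp
    show "(norm (f x - T n (f x)))\<^sup>2 \<le> (norm (f x))\<^sup>2" for n x
      using closest_point_le[of "cball (0::complex) (real n)" 0 "f x"]
      by (intro power_mono) (auto simp: T_def dist_norm)
    have "(\<lambda>n. T n (f x)) \<longlonglongrightarrow> f x" for x
    proof (rule tendsto_eventually)
      obtain n0 where "norm (f x) \<le> real n0"
        using real_arch_simple by blast
      then show "\<forall>\<^sub>F n in sequentially. T n (f x) = f x"
        by (intro eventually_sequentiallyI[of n0]) (auto simp: T_def intro!: closest_point_self)
    qed
    then show "AE x in lebesgue_on {-L..L}. (\<lambda>n. T n (f x)) \<longlonglongrightarrow> f x"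
      by simp
  qed
  then show ?thesis
    by (rule trig_approximable_limit[OF assms T(1) _ T(2)])
qed

section \<open>Convergence of the Fourier series\<close>

lemma fourier_coeff_altdef:
  "fourier_coeff L f k
     = (LINT x|lebesgue_on {-L..L}. f x * fourier_eigenfunction L (- k) x) / (2 * complex_of_real L)"
  by (simp add: fourier_coeff_def fourier_eigenfunction_def)

lemma fourier_coeff_scale: "fourier_coeff L (\<lambda>x. c * f x) k = c * fourier_coeff L f k"
  by (simp add: fourier_coeff_altdef mult.assoc)

lemma fourier_coeff_add:
  assumes "L > 0" "square_integrable L f" "square_integrable L g"
  shows "fourier_coeff L (\<lambda>x. f x + g x) k = fourier_coeff L f k + fourier_coeff L g k"
  using square_integrable_mult_eigenfunction[OF assms(1)] assms
  by (simp add: fourier_coeff_altdef distrib_right add_divide_distrib)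

lemma fourier_coeff_diff:
  assumes "L > 0" "square_integrable L f" "square_integrable L g"
  shows "fourier_coeff L (\<lambda>x. f x - g x) k = fourier_coeff L f k - fourier_coeff L g k"
  using square_integrable_mult_eigenfunction[OF assms(1)] assms
  by (simp add: fourier_coeff_altdef left_diff_distrib diff_divide_distrib)

lemma fourier_coeff_eigenfunction:
  assumes "L > 0"
  shows "fourier_coeff L (fourier_eigenfunction L j) k = (if j = k then 1 else 0)"
  using assms integral_fourier_eigenfunction[OF assms, of "j - k"]
  by (simp add: fourier_coeff_altdef fourier_eigenfunction_add[symmetric])

definition fourier_sum :: "real \<Rightarrow> (real \<Rightarrow> complex) \<Rightarrow> int set \<Rightarrow> real \<Rightarrow> complex" where
  "fourier_sum L f A x = (\<Sum>k\<in>A. fourier_coeff L f k * fourier_eigenfunction L k x)"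

lemma continuous_fourier_sum:
  assumes "L > 0"
  shows "continuous_on S (fourier_sum L f A)"
  unfolding fourier_sum_def by (intro continuous_intros assms)

text \<open>
  Expanding the square, the cross term contributes \<open>- 4 * L * (norm c)\<^sup>2\<close> and the square of
  the subtracted term \<open>2 * L * (norm c)\<^sup>2\<close>, where \<open>c\<close> is the Fourier coefficient.
\<close>

lemma L2_norm_diff_projection:
  assumes "L > 0" "square_integrable L f"
  shows "L2_norm L (\<lambda>x. f x - fourier_coeff L f k * fourier_eigenfunction L k x) \<le> L2_norm L f"
proof -
  define c where "c = fourier_coeff L f k"
  define e where "e = fourier_eigenfunction L k"
  have int: "integrable (lebesgue_on {-L..L}) (\<lambda>x. f x * cnj (e x))"
    using square_integrable_mult_eigenfunction[OF assms] by (simp add: e_def cnj_fourier_eigenfunction)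
  have "(LINT x|lebesgue_on {-L..L}. f x * cnj (e x)) = 2 * L * c"
    using assms(1) by (simp add: c_def e_def cnj_fourier_eigenfunction fourier_coeff_altdef)
  then have "(LINT x|lebesgue_on {-L..L}. cnj c * (f x * cnj (e x))) = 2 * L * (c * cnj c)"
    by simp
  also have "\<dots> = complex_of_real (2 * L * (norm c)\<^sup>2)"
    by (simp only: of_real_mult complex_norm_square of_real_numeral)
  finally have *: "(LINT x|lebesgue_on {-L..L}. cnj c * (f x * cnj (e x))) = complex_of_real (2 * L * (norm c)\<^sup>2)" .
  define r where "r = (\<lambda>x. Re (cnj c * (f x * cnj (e x))))"
  have int_r: "integrable (lebesgue_on {-L..L}) r"
    unfolding r_def by (intro integrable_Re integrable_mult_right int)
  have r: "(LINT x|lebesgue_on {-L..L}. r x) = 2 * L * (norm c)\<^sup>2"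
    unfolding r_def using int by (subst integral_Re) (simp_all only: * Re_complex_of_real integrable_mult_right)
  have eq: "(norm (f x - c * e x))\<^sup>2 = (norm (f x))\<^sup>2 - 2 * r x + (norm c)\<^sup>2" for x
  proof -
    have "(norm (f x - c * e x))\<^sup>2 = (norm (f x))\<^sup>2 - 2 * r x + (norm (c * e x))\<^sup>2"
      unfolding cmod_power2 r_def by (simp add: power2_eq_square algebra_simps)
    then show ?thesis
      by (simp add: norm_mult e_def)
  qed
  have "(LINT x|lebesgue_on {-L..L}. (norm (f x - c * e x))\<^sup>2)
      = (LINT x|lebesgue_on {-L..L}. (norm (f x))\<^sup>2) - 2 * (2 * L * (norm c)\<^sup>2) + 2 * L * (norm c)\<^sup>2"
    unfolding eq using assms int_r r
    by (simp add: square_integrable_def measure_restrict_space)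
  also have "\<dots> \<le> (LINT x|lebesgue_on {-L..L}. (norm (f x))\<^sup>2)"
    using assms(1) by simp
  finally show ?thesis
    unfolding L2_norm_def c_def e_def by simp
qed

lemma fourier_coeff_sum:
  assumes "L > 0" "finite A"
  shows "fourier_coeff L (fourier_sum L f A) k = (if k \<in> A then fourier_coeff L f k else 0)"
  using assms(2)
proof induction
  case empty
  then show ?case
    by (simp add: fourier_sum_def fourier_coeff_altdef)
next
  case (insert j A)
  have "fourier_sum L f (insert j A) = (\<lambda>x. fourier_coeff L f j * fourier_eigenfunction L j x + fourier_sum L f A x)"
    using insert.hyps by (auto simp: fourier_sum_def)
  then have "fourier_coeff L (fourier_sum L f (insert j A)) k
      = fourier_coeff L f j * (if j = k then 1 else 0) + fourier_coeff L (fourier_sum L f A) k"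
    using assms(1)
    by (simp add: fourier_coeff_add fourier_coeff_scale fourier_coeff_eigenfunction continuous_imp_square_integrable
        square_integrable_scale continuous_fourier_eigenfunction continuous_fourier_sum)
  then show ?case
    using insert by auto
qed

text \<open>
  Bessel's inequality, one frequency at a time: subtracting the terms already
  treated leaves the coefficient of the next frequency unchanged, so each step is again the removal of
  a projection.
\<close>

lemma L2_norm_diff_fourier_sum:
  assumes "L > 0" "square_integrable L f" "finite A"
  shows "L2_norm L (\<lambda>x. f x - fourier_sum L f A x) \<le> L2_norm L f"
  using assms(3)
proof induction
  case empty
  then show ?case
    by (simp add: fourier_sum_def)
next
  case (insert j A)
  have S: "square_integrable L (fourier_sum L f A)"
    by (intro continuous_imp_square_integrable continuous_fourier_sum assms)
  let ?r = "\<lambda>x. f x - fourier_sum L f A x"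
  have "fourier_coeff L ?r j = fourier_coeff L f j"
    using insert.hyps by (simp add: fourier_coeff_diff[OF assms(1,2) S] fourier_coeff_sum[OF assms(1)])
  then have "(\<lambda>x. f x - fourier_sum L f (insert j A) x) = (\<lambda>x. ?r x - fourier_coeff L ?r j * fourier_eigenfunction L j x)"
    using insert.hyps by (auto simp: fourier_sum_def)
  then have "L2_norm L (\<lambda>x. f x - fourier_sum L f (insert j A) x) \<le> L2_norm L ?r"
    using L2_norm_diff_projection[OF assms(1) square_integrable_diff[OF assms(2) S], of j] by simp
  also note insert.IH
  finally show ?case .
qed

lemma fourier_sum_trig_poly:
  assumes "L > 0" "trig_poly L p"
  shows "\<exists>B. finite B \<and> (\<forall>A. finite A \<longrightarrow> B \<subseteq> A \<longrightarrow> fourier_sum L p A = p)"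
  using assms(2)
proof induction
  case (basis j)
  have "fourier_sum L (fourier_eigenfunction L j) A = fourier_eigenfunction L j" if "finite A" "{j} \<subseteq> A" for A
    using that by (auto simp: fourier_sum_def fourier_coeff_eigenfunction[OF assms(1)] if_distrib if_distribR cong: if_cong)
  then show ?case
    by (intro exI[of _ "{j}"]) auto
next
  case (scale p c)
  have "fourier_sum L (\<lambda>x. c * p x) A = (\<lambda>x. c * fourier_sum L p A x)" for A
    by (auto simp: fourier_sum_def fourier_coeff_scale sum_distrib_left mult.assoc)
  then show ?case
    using scale.IH by metis
next
  case (add p q)
  have "square_integrable L p" "square_integrable L q"
    using square_integrable_trig_poly[OF assms(1)] add.hyps by auto
  then have sum: "fourier_sum L (\<lambda>x. p x + q x) A = (\<lambda>x. fourier_sum L p A x + fourier_sum L q A x)" for A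
    by (auto simp: fourier_sum_def fourier_coeff_add[OF assms(1)] distrib_right sum.distrib)
  obtain B C where "finite B" "\<And>A. finite A \<Longrightarrow> B \<subseteq> A \<Longrightarrow> fourier_sum L p A = p"
    "finite C" "\<And>A. finite A \<Longrightarrow> C \<subseteq> A \<Longrightarrow> fourier_sum L q A = q"
    using add.IH by blast
  then show ?case
    by (intro exI[of _ "B \<union> C"]) (simp add: sum)
qed

text \<open>
  Convergence along all finite sets of frequencies, of which the two-sided series is a special case.
\<close>

lemma fourier_sum_converges:
  assumes "L > 0" "square_integrable L f"
  shows "((\<lambda>A. L2_norm L (\<lambda>x. f x - fourier_sum L f A x)) \<longlongrightarrow> 0) (finite_subsets_at_top UNIV)"
proof (rule tendstoI)
  fix e :: real assume "e > 0"
  then obtain p where p: "trig_poly L p" "L2_norm L (\<lambda>x. f x - p x) < e"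
    using square_integrable_trig_approximable[OF assms] unfolding trig_approximable_def by blast
  obtain B where B: "finite B" "\<And>A. finite A \<Longrightarrow> B \<subseteq> A \<Longrightarrow> fourier_sum L p A = p"
    using fourier_sum_trig_poly[OF assms(1) p(1)] by blast
  have sqp: "square_integrable L p"
    by (rule square_integrable_trig_poly[OF assms(1) p(1)])
  have "L2_norm L (\<lambda>x. f x - fourier_sum L f A x) < e" if A: "finite A" "B \<subseteq> A" for A
  proof -
    have "fourier_sum L (\<lambda>x. f x - p x) A x = fourier_sum L f A x - p x" for x
      using fun_cong[OF B(2)[OF A], of x]
      by (simp add: fourier_sum_def fourier_coeff_diff[OF assms sqp] left_diff_distrib sum_subtractf)
    then have "L2_norm L (\<lambda>x. f x - fourier_sum L f A x)
        = L2_norm L (\<lambda>x. (f x - p x) - fourier_sum L (\<lambda>x. f x - p x) A x)"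
      by simp
    also have "\<dots> \<le> L2_norm L (\<lambda>x. f x - p x)"
      by (rule L2_norm_diff_fourier_sum[OF assms(1) square_integrable_diff[OF assms(2) sqp] A(1)])
    also note p(2)
    finally show ?thesis .
  qed
  then show "\<forall>\<^sub>F A in finite_subsets_at_top UNIV. dist (L2_norm L (\<lambda>x. f x - fourier_sum L f A x)) 0 < e"
    unfolding eventually_finite_subsets_at_top using B(1) by auto
qed

lemma integer_intervals_exhaust:
  "filterlim (\<lambda>(m, n). {- int m..int n}) (finite_subsets_at_top UNIV) (sequentially \<times>\<^sub>F sequentially)"
  unfolding filterlim_finite_subsets_at_top
proof (intro allI impI)
  fix B :: "int set" assume B: "finite B \<and> B \<subseteq> UNIV"
  define N where "N = nat (Max (insert 0 (abs ` B)))"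
  have "\<bar>k\<bar> \<le> int N" if "k \<in> B" for k
    using B that Max_ge[of "insert 0 (abs ` B)" "\<bar>k\<bar>"] by (simp add: N_def)
  then have B_sub: "B \<subseteq> {- int m..int n}" if "N \<le> m" "N \<le> n" for m n
    using that by fastforce
  have "\<forall>\<^sub>F mn in sequentially \<times>\<^sub>F sequentially. N \<le> fst mn \<and> N \<le> snd mn"
    by (intro eventually_prodI eventually_ge_at_top)
  then show "\<forall>\<^sub>F mn in sequentially \<times>\<^sub>F sequentially.
      finite (case mn of (m, n) \<Rightarrow> {- int m..int n}) \<and> B \<subseteq> (case mn of (m, n) \<Rightarrow> {- int m..int n})
      \<and> (case mn of (m, n) \<Rightarrow> {- int m..int n}) \<subseteq> UNIV"
    by (rule eventually_mono) (simp add: case_prod_unfold B_sub)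
qed

lemma fourier_series_converges:
  assumes "L > 0" "square_integrable L f"
  shows "L2_series_converges L (\<lambda>k x. fourier_coeff L f k * fourier_eigenfunction L k x) f"
  using filterlim_compose[OF fourier_sum_converges[OF assms] integer_intervals_exhaust]
  unfolding L2_series_converges_def by (simp add: case_prod_unfold fourier_sum_def)

lemma fourier_complete:
  assumes "L > 0" "square_integrable L f" and zero: "\<And>k. fourier_coeff L f k = 0"
  shows "AE x in lebesgue_on {-L..L}. f x = 0"
proof -
  have "((\<lambda>A::int set. L2_norm L f) \<longlongrightarrow> 0) (finite_subsets_at_top UNIV)"
    using fourier_sum_converges[OF assms(1,2)] by (simp add: fourier_sum_def zero)
  then have "L2_norm L f = 0"
    by (simp add: tendsto_const_iff)
  then have "(LINT x|lebesgue_on {-L..L}. (cmod (f x))\<^sup>2) = 0"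
    by (simp add: L2_norm_def)
  then have "AE x in lebesgue_on {-L..L}. (cmod (f x))\<^sup>2 = 0"
    using assms(2) by (subst (asm) integral_nonneg_eq_0_iff_AE) (auto simp: square_integrable_def)
  then show ?thesis
    by simp
qed

section \<open>The eigenfunction expansion\<close>

theorem theorem1:
  fixes L :: real
  assumes "L > 0"
  shows "{lam. is_eigenvalue L lam} = range (fourier_eigenvalue L)
    \<and> inj (fourier_eigenvalue L)
    \<and> (\<forall>k y. is_eigenfunction L (fourier_eigenvalue L k) y \<longleftrightarrow>
          (\<exists>c. c \<noteq> 0 \<and> (\<forall>x\<in>{-L..L}. y x = c * fourier_eigenfunction L k x)))
    \<and> (\<forall>j k. j \<noteq> k \<longrightarrow>
          L2_inner L (fourier_eigenfunction L j) (fourier_eigenfunction L k) = 0)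
    \<and> (\<forall>f. square_integrable L f \<longrightarrow>
          (\<forall>k::int. (LINT x|lebesgue_on {-L..L}.
                      f x * exp (\<i> * complex_of_real (of_int k * pi * x / L))) = 0) \<longrightarrow>
          (AE x in lebesgue_on {-L..L}. f x = 0))
    \<and> (\<forall>f. square_integrable L f \<longrightarrow>
          L2_series_converges L (\<lambda>k x. fourier_coeff L f k * fourier_eigenfunction L k x) f)"
proof (intro conjI allI impI)
  show "{lam. is_eigenvalue L lam} = range (fourier_eigenvalue L)"
    using eigenvalue_iff[OF assms] by auto
  show "inj (fourier_eigenvalue L)"
    using assms by (auto simp: inj_def fourier_eigenvalue_def)
  show "is_eigenfunction L (fourier_eigenvalue L k) y \<longleftrightarrow>
      (\<exists>c. c \<noteq> 0 \<and> (\<forall>x\<in>{-L..L}. y x = c * fourier_eigenfunction L k x))" for k y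
    by (rule eigenfunction_iff[OF assms])
  show "L2_inner L (fourier_eigenfunction L j) (fourier_eigenfunction L k) = 0" if "j \<noteq> k" for j k
    using assms that by (rule L2_inner_fourier_eigenfunction)
  show "AE x in lebesgue_on {-L..L}. f x = 0"
    if "square_integrable L f" "\<forall>k::int. (LINT x|lebesgue_on {-L..L}.
          f x * exp (\<i> * complex_of_real (of_int k * pi * x / L))) = 0" for f
    using that(2) by (intro fourier_complete[OF assms that(1)]) (simp only: fourier_coeff_def mult_zero_right)
  show "L2_series_converges L (\<lambda>k x. fourier_coeff L f k * fourier_eigenfunction L k x) f"
    if "square_integrable L f" for f
    using assms that by (rule fourier_series_converges)
qed

end
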